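(* Let $d$ be an integer and let $\mathcal{C}$ be an indecomposable $d$-Calabi-Yau triangulated category. If $d\geq 1$, then the co-t-structures in $\mathcal{C}$ are $(\mathcal{C},0)$ and $(0,\mathcal{C})$. Dually, if $d\leq -1$, then the t-structures in $\mathcal{C}$ are $(\mathcal{C},0)$ and $(0,\mathcal{C})$.
   Context: Fix a field $k$. All triangulated categories are $k$-linear, Hom-finite and Krull-Schmidt, with shift functor $[1]$; $\mathrm{Ext}^n(X,Y)=\mathrm{Hom}(X,Y[n])$. A subcategory means a full subcategory closed under isomorphisms, finite direct sums and direct summands. A triangulated subcategory is a subcategory closed under $[1]$, $[-1]$ and extensions. For subcategories, $\mathcal{X}*\mathcal{Y}$ is the class of objects $Z$ admitting a triangle $X\to Z\to Y\to X[1]$ with $X\in\mathcal{X}$, $Y\in\mathcal{Y}$. $\mathcal{C}$ is $d$-Calabi-Yau if $[d]$ is a Serre functor: $\mathrm{Hom}(X,Y)\cong \mathrm{Hom}_k(\mathrm{Hom}(Y,X[d]),k)$ functorially. $\mathcal{C}$ is indecomposable if there are no two nonzero triangulated subcategories $\mathcal{C}_1,\mathcal{C}_2$ with $\mathrm{Hom}(\mathcal{C}_1,\mathcal{C}_2)=0=\mathrm{Hom}(\mathcal{C}_2,\mathcal{C}_1)$ such that every object is a direct sum of an object of $\mathcal{C}_1$ and one of $\mathcal{C}_2$. A cotorsion pair in $\mathcal{C}$ is a pair $(\mathcal{X},\mathcal{Y})$ of subcategories with $\mathrm{Ext}^1(\mathcal{X},\mathcal{Y})=0$ and $\mathcal{C}=\mathcal{X}*\mathcal{Y}[1]$.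 It is a t-structure if $\mathcal{X}$ is closed under $[1]$ (equivalently $\mathcal{Y}$ is closed under $[-1]$), and a co-t-structure if $\mathcal{X}$ is closed under $[-1]$ (equivalently $\mathcal{Y}$ is closed under $[1]$). *)

theory Defs
  imports "Jordan_Normal_Form.Missing_VectorSpace"
begin

section \<open>Linear categories\<close>

text \<open>
  A category enriched in vector spaces over a field \<open>K\<close> is given by a set of objects and, for each
  pair of objects, a module record over \<open>K\<close>. Its multiplicative fields are junk. Hom spaces of
  different pairs of objects are not required to be disjoint: every notion below that depends on
  source and target mentions them explicitly. \<open>Comp C g f\<close> is \<open>g\<close> after \<open>f\<close>.
\<close>

record ('k, 'o, 'm) lin_cat =
  Ob :: "'o set"
  Hom :: "'o \<Rightarrow> 'o \<Rightarrow> ('k, 'm) module"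
  Id :: "'o \<Rightarrow> 'm"
  Comp :: "'m \<Rightarrow> 'm \<Rightarrow> 'm" (infixr \<open>\<cdot>\<index>\<close> 75)

abbreviation Mor :: "('k, 'o, 'm, 'z) lin_cat_scheme \<Rightarrow> 'o \<Rightarrow> 'o \<Rightarrow> 'm set"
  where "Mor C X Y \<equiv> carrier (Hom C X Y)"

abbreviation Zero :: "('k, 'o, 'm, 'z) lin_cat_scheme \<Rightarrow> 'o \<Rightarrow> 'o \<Rightarrow> 'm"
  where "Zero C X Y \<equiv> zero (Hom C X Y)"

locale linear_category = field K for K :: "('k, 'r) ring_scheme" (structure) +
  fixes C :: "('k, 'o, 'm, 'z) lin_cat_scheme" (structure)
  assumes hom_vectorspace: "\<lbrakk>X \<in> Ob C; Y \<in> Ob C\<rbrakk> \<Longrightarrow> vectorspace K (Hom C X Y)"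
    and id_closed: "X \<in> Ob C \<Longrightarrow> Id C X \<in> Mor C X X"
    and comp_closed:
      "\<lbrakk>X \<in> Ob C; Y \<in> Ob C; Z \<in> Ob C; f \<in> Mor C X Y; g \<in> Mor C Y Z\<rbrakk> \<Longrightarrow> g \<cdot>\<^bsub>C\<^esub> f \<in> Mor C X Z"
    and comp_assoc:
      "\<lbrakk>W \<in> Ob C; X \<in> Ob C; Y \<in> Ob C; Z \<in> Ob C;
        f \<in> Mor C W X; g \<in> Mor C X Y; h \<in> Mor C Y Z\<rbrakk>
       \<Longrightarrow> (h \<cdot>\<^bsub>C\<^esub> g) \<cdot>\<^bsub>C\<^esub> f = h \<cdot>\<^bsub>C\<^esub> (g \<cdot>\<^bsub>C\<^esub> f)"
    and comp_id_right: "\<lbrakk>X \<in> Ob C; Y \<in> Ob C; f \<in> Mor C X Y\<rbrakk> \<Longrightarrow> f \<cdot>\<^bsub>C\<^esub> Id C X = f"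
    and comp_id_left: "\<lbrakk>X \<in> Ob C; Y \<in> Ob C; f \<in> Mor C X Y\<rbrakk> \<Longrightarrow> Id C Y \<cdot>\<^bsub>C\<^esub> f = f"
    and comp_linear_right:
      "\<lbrakk>X \<in> Ob C; Y \<in> Ob C; Z \<in> Ob C; g \<in> Mor C Y Z\<rbrakk>
       \<Longrightarrow> (\<lambda>f. g \<cdot>\<^bsub>C\<^esub> f) \<in> module_hom K (Hom C X Y) (Hom C X Z)"
    and comp_linear_left:
      "\<lbrakk>X \<in> Ob C; Y \<in> Ob C; Z \<in> Ob C; f \<in> Mor C X Y\<rbrakk>
       \<Longrightarrow> (\<lambda>g. g \<cdot>\<^bsub>C\<^esub> f) \<in> module_hom K (Hom C Y Z) (Hom C X Z)"

definition iso_mor :: "('k, 'o, 'm, 'z) lin_cat_scheme \<Rightarrow> 'o \<Rightarrow> 'o \<Rightarrow> 'm \<Rightarrow> bool"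
  where "iso_mor C X Y f \<longleftrightarrow> f \<in> Mor C X Y \<and>
    (\<exists>g \<in> Mor C Y X. g \<cdot>\<^bsub>C\<^esub> f = Id C X \<and> f \<cdot>\<^bsub>C\<^esub> g = Id C Y)"

definition isomorphic :: "('k, 'o, 'm, 'z) lin_cat_scheme \<Rightarrow> 'o \<Rightarrow> 'o \<Rightarrow> bool"
  where "isomorphic C X Y \<longleftrightarrow> (\<exists>f. iso_mor C X Y f)"

definition zero_objects :: "('k, 'o, 'm, 'z) lin_cat_scheme \<Rightarrow> 'o set"
  where "zero_objects C =
    {Z \<in> Ob C. \<forall>X \<in> Ob C. Mor C X Z = {Zero C X Z} \<and> Mor C Z X = {Zero C Z X}}"

text \<open>
  \<open>is_direct_sum C Xs Z\<close>: the object \<open>Z\<close> is a biproduct of the finite list \<open>Xs\<close> of objects. The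
  direct sums of the empty list are the zero objects.
\<close>

definition is_direct_sum :: "('k, 'o, 'm, 'z) lin_cat_scheme \<Rightarrow> 'o list \<Rightarrow> 'o \<Rightarrow> bool"
  where "is_direct_sum C Xs Z \<longleftrightarrow> set Xs \<subseteq> Ob C \<and> Z \<in> Ob C \<and>
    (\<exists>\<iota> \<pi>.
      (\<forall>i < length Xs. \<iota> i \<in> Mor C (Xs ! i) Z \<and> \<pi> i \<in> Mor C Z (Xs ! i)) \<and>
      (\<forall>i < length Xs. \<forall>j < length Xs.
        \<pi> i \<cdot>\<^bsub>C\<^esub> \<iota> j = (if i = j then Id C (Xs ! i) else Zero C (Xs ! j) (Xs ! i))) \<and>
      (\<Oplus>\<^bsub>Hom C Z Z\<^esub> i \<in> {..<length Xs}. \<iota> i \<cdot>\<^bsub>C\<^esub> \<pi> i) = Id C Z)"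

locale additive_category = linear_category K C
  for K :: "('k, 'r) ring_scheme" (structure) and C :: "('k, 'o, 'm, 'z) lin_cat_scheme" (structure) +
  assumes direct_sum_exists: "set Xs \<subseteq> Ob C \<Longrightarrow> \<exists>Z. is_direct_sum C Xs Z"

definition hom_finite :: "('k, 'r) ring_scheme \<Rightarrow> ('k, 'o, 'm, 'z) lin_cat_scheme \<Rightarrow> bool"
  where "hom_finite K C \<longleftrightarrow> (\<forall>X \<in> Ob C. \<forall>Y \<in> Ob C. vectorspace.fin_dim K (Hom C X Y))"

definition End_ring :: "('k, 'o, 'm, 'z) lin_cat_scheme \<Rightarrow> 'o \<Rightarrow> 'm ring"
  where "End_ring C X = \<lparr>carrier = Mor C X X, mult = Comp C, one = Id C X,
    zero = Zero C X X, add = add (Hom C X X)\<rparr>"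

text \<open>A possibly noncommutative ring is local if it is nonzero and its non-units are closed under
  addition.\<close>

definition is_local_ring :: "('a, 'r) ring_scheme \<Rightarrow> bool"
  where "is_local_ring R \<longleftrightarrow> ring R \<and> \<one>\<^bsub>R\<^esub> \<noteq> \<zero>\<^bsub>R\<^esub> \<and>
    (\<forall>a \<in> carrier R - Units R. \<forall>b \<in> carrier R - Units R. a \<oplus>\<^bsub>R\<^esub> b \<notin> Units R)"

definition krull_schmidt :: "('k, 'o, 'm, 'z) lin_cat_scheme \<Rightarrow> bool"
  where "krull_schmidt C \<longleftrightarrow>
    (\<forall>X \<in> Ob C. \<exists>Xs. is_direct_sum C Xs X \<and> (\<forall>Y \<in> set Xs. is_local_ring (End_ring C Y)))"


section \<open>Triangulated categories\<close>

text \<open>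
  The shift functor is an automorphism, so it generates a strict action of the integers;
  \<open>shift C n X\<close> is \<open>X[n]\<close> and \<open>shift_mor C n f\<close> is \<open>f[n]\<close>. The tuple \<open>(X, Y, Z, f, g, h)\<close> encodes
  the triangle \<open>X \<rightarrow> Y \<rightarrow> Z \<rightarrow> X[1]\<close> with maps \<open>f\<close>, \<open>g\<close>, \<open>h\<close>.
\<close>

record ('k, 'o, 'm) tri_cat = "('k, 'o, 'm) lin_cat" +
  shift :: "int \<Rightarrow> 'o \<Rightarrow> 'o"
  shift_mor :: "int \<Rightarrow> 'm \<Rightarrow> 'm"
  dist_tri :: "('o \<times> 'o \<times> 'o \<times> 'm \<times> 'm \<times> 'm) set"

definition triangles :: "('k, 'o, 'm, 'z) tri_cat_scheme \<Rightarrow> ('o \<times> 'o \<times> 'o \<times> 'm \<times> 'm \<times> 'm) set"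
  where "triangles C = {(X, Y, Z, f, g, h). X \<in> Ob C \<and> Y \<in> Ob C \<and> Z \<in> Ob C \<and>
    f \<in> Mor C X Y \<and> g \<in> Mor C Y Z \<and> h \<in> Mor C Z (shift C 1 X)}"

locale triangulated_category = additive_category K C
  for K :: "('k, 'r) ring_scheme" (structure) and C :: "('k, 'o, 'm, 'z) tri_cat_scheme" (structure) +
  assumes shift_closed: "X \<in> Ob C \<Longrightarrow> shift C n X \<in> Ob C"
    and shift_zero: "X \<in> Ob C \<Longrightarrow> shift C 0 X = X"
    and shift_add: "X \<in> Ob C \<Longrightarrow> shift C m (shift C n X) = shift C (m + n) X"
    and shift_mor_linear: "\<lbrakk>X \<in> Ob C; Y \<in> Ob C\<rbrakk>
      \<Longrightarrow> shift_mor C n \<in> module_hom K (Hom C X Y) (Hom C (shift C n X) (shift C n Y))"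
    and shift_mor_id: "X \<in> Ob C \<Longrightarrow> shift_mor C n (Id C X) = Id C (shift C n X)"
    and shift_mor_comp: "\<lbrakk>X \<in> Ob C; Y \<in> Ob C; Z \<in> Ob C; f \<in> Mor C X Y; g \<in> Mor C Y Z\<rbrakk>
      \<Longrightarrow> shift_mor C n (g \<cdot>\<^bsub>C\<^esub> f) = shift_mor C n g \<cdot>\<^bsub>C\<^esub> shift_mor C n f"
    and shift_mor_zero: "\<lbrakk>X \<in> Ob C; Y \<in> Ob C; f \<in> Mor C X Y\<rbrakk> \<Longrightarrow> shift_mor C 0 f = f"
    and shift_mor_add: "\<lbrakk>X \<in> Ob C; Y \<in> Ob C; f \<in> Mor C X Y\<rbrakk>
      \<Longrightarrow> shift_mor C m (shift_mor C n f) = shift_mor C (m + n) f"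
    and dist_triangles: "dist_tri C \<subseteq> triangles C"
    and TR1_iso:
      "\<lbrakk>(X, Y, Z, f, g, h) \<in> dist_tri C; (X', Y', Z', f', g', h') \<in> triangles C;
        iso_mor C X X' a; iso_mor C Y Y' b; iso_mor C Z Z' c;
        b \<cdot>\<^bsub>C\<^esub> f = f' \<cdot>\<^bsub>C\<^esub> a; c \<cdot>\<^bsub>C\<^esub> g = g' \<cdot>\<^bsub>C\<^esub> b; shift_mor C 1 a \<cdot>\<^bsub>C\<^esub> h = h' \<cdot>\<^bsub>C\<^esub> c\<rbrakk>
       \<Longrightarrow> (X', Y', Z', f', g', h') \<in> dist_tri C"
    and TR1_id:
      "\<lbrakk>X \<in> Ob C; Z \<in> zero_objects C\<rbrakk>
       \<Longrightarrow> (X, X, Z, Id C X, Zero C X Z, Zero C Z (shift C 1 X)) \<in> dist_tri C"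
    and TR1_cone:
      "\<lbrakk>X \<in> Ob C; Y \<in> Ob C; f \<in> Mor C X Y\<rbrakk> \<Longrightarrow> \<exists>Z g h. (X, Y, Z, f, g, h) \<in> dist_tri C"
    and TR2:
      "(X, Y, Z, f, g, h) \<in> triangles C \<Longrightarrow>
       (X, Y, Z, f, g, h) \<in> dist_tri C \<longleftrightarrow>
       (Y, Z, shift C 1 X, g, h, \<ominus>\<^bsub>Hom C (shift C 1 X) (shift C 1 Y)\<^esub> shift_mor C 1 f) \<in> dist_tri C"
    and TR3:
      "\<lbrakk>(X, Y, Z, f, g, h) \<in> dist_tri C; (X', Y', Z', f', g', h') \<in> dist_tri C;
        a \<in> Mor C X X'; b \<in> Mor C Y Y'; b \<cdot>\<^bsub>C\<^esub> f = f' \<cdot>\<^bsub>C\<^esub> a\<rbrakk>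
       \<Longrightarrow> \<exists>c \<in> Mor C Z Z'. c \<cdot>\<^bsub>C\<^esub> g = g' \<cdot>\<^bsub>C\<^esub> b \<and> shift_mor C 1 a \<cdot>\<^bsub>C\<^esub> h = h' \<cdot>\<^bsub>C\<^esub> c"
    and TR4:
      "\<lbrakk>(X, Y, Z', f, f1, f2) \<in> dist_tri C; (Y, Z, X', g, g1, g2) \<in> dist_tri C;
        (X, Z, Y', g \<cdot>\<^bsub>C\<^esub> f, h1, h2) \<in> dist_tri C\<rbrakk>
       \<Longrightarrow> \<exists>u v. (Z', Y', X', u, v, shift_mor C 1 f1 \<cdot>\<^bsub>C\<^esub> g2) \<in> dist_tri C \<and>
             u \<cdot>\<^bsub>C\<^esub> f1 = h1 \<cdot>\<^bsub>C\<^esub> g \<and> h2 \<cdot>\<^bsub>C\<^esub> u = f2 \<and>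
             v \<cdot>\<^bsub>C\<^esub> h1 = g1 \<and> g2 \<cdot>\<^bsub>C\<^esub> v = shift_mor C 1 f \<cdot>\<^bsub>C\<^esub> h2"


section \<open>Calabi--Yau categories\<close>

definition regular_module :: "('k, 'r) ring_scheme \<Rightarrow> ('k, 'k) module"
  where "regular_module K = \<lparr>carrier = carrier K, mult = mult K, one = one K,
    zero = zero K, add = add K, smult = mult K\<rparr>"

text \<open>Linear functionals are taken to be extensional, so that equality in the dual space is equality
  of functionals on \<open>V\<close>.\<close>

definition dual_space :: "('k, 'r) ring_scheme \<Rightarrow> ('k, 'v) module \<Rightarrow> ('k, 'v \<Rightarrow> 'k) module"
  where "dual_space K V = (ring.func_space K (carrier V))
    \<lparr>carrier := module_hom K V (regular_module K) \<inter> extensional (carrier V)\<rparr>"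

text \<open>
  A natural isomorphism between the functors \<open>(X, Y) \<mapsto> Hom (X, Y)\<close> and \<open>(X, Y) \<mapsto> D Hom (Y, X[d])\<close>,
  contravariant in \<open>X\<close> and covariant in \<open>Y\<close>.
\<close>

definition calabi_yau ::
  "('k, 'r) ring_scheme \<Rightarrow> ('k, 'o, 'm, 'z) tri_cat_scheme \<Rightarrow> int \<Rightarrow> bool"
  where "calabi_yau K C d \<longleftrightarrow>
    (\<exists>\<Phi> :: 'o \<Rightarrow> 'o \<Rightarrow> 'm \<Rightarrow> 'm \<Rightarrow> 'k.
      (\<forall>X \<in> Ob C. \<forall>Y \<in> Ob C.
        \<Phi> X Y \<in> module_hom K (Hom C X Y) (dual_space K (Hom C Y (shift C d X))) \<and>
        bij_betw (\<Phi> X Y) (Mor C X Y) (carrier (dual_space K (Hom C Y (shift C d X))))) \<and>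
      (\<forall>X \<in> Ob C. \<forall>X' \<in> Ob C. \<forall>Y \<in> Ob C. \<forall>Y' \<in> Ob C.
        \<forall>f \<in> Mor C X' X. \<forall>g \<in> Mor C Y Y'. \<forall>h \<in> Mor C X Y. \<forall>u \<in> Mor C Y' (shift C d X').
          \<Phi> X' Y' (g \<cdot>\<^bsub>C\<^esub> h \<cdot>\<^bsub>C\<^esub> f) u = \<Phi> X Y h (shift_mor C d f \<cdot>\<^bsub>C\<^esub> u \<cdot>\<^bsub>C\<^esub> g)))"


section \<open>Subcategories\<close>

text \<open>All subcategories are full, hence are given by their sets of objects.\<close>

definition subcategory :: "('k, 'o, 'm, 'z) lin_cat_scheme \<Rightarrow> 'o set \<Rightarrow> bool"
  where "subcategory C S \<longleftrightarrow> S \<subseteq> Ob C \<and>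
    (\<forall>X \<in> S. \<forall>Y \<in> Ob C. isomorphic C X Y \<longrightarrow> Y \<in> S) \<and>
    (\<forall>Xs Z. set Xs \<subseteq> S \<and> is_direct_sum C Xs Z \<longrightarrow> Z \<in> S) \<and>
    (\<forall>X Y. \<forall>Z \<in> S. is_direct_sum C [X, Y] Z \<longrightarrow> X \<in> S)"

definition hom_orthogonal :: "('k, 'o, 'm, 'z) lin_cat_scheme \<Rightarrow> 'o set \<Rightarrow> 'o set \<Rightarrow> bool"
  where "hom_orthogonal C S T \<longleftrightarrow> (\<forall>X \<in> S. \<forall>Y \<in> T. Mor C X Y = {Zero C X Y})"

definition extension_product :: "('k, 'o, 'm, 'z) tri_cat_scheme \<Rightarrow> 'o set \<Rightarrow> 'o set \<Rightarrow> 'o set"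
  where "extension_product C S T =
    {Z \<in> Ob C. \<exists>X \<in> S. \<exists>Y \<in> T. \<exists>f g h. (X, Z, Y, f, g, h) \<in> dist_tri C}"

definition triangulated_subcategory :: "('k, 'o, 'm, 'z) tri_cat_scheme \<Rightarrow> 'o set \<Rightarrow> bool"
  where "triangulated_subcategory C S \<longleftrightarrow> subcategory C S \<and>
    shift C 1 ` S \<subseteq> S \<and> shift C (-1) ` S \<subseteq> S \<and> extension_product C S S \<subseteq> S"

definition indecomposable_category :: "('k, 'o, 'm, 'z) tri_cat_scheme \<Rightarrow> bool"
  where "indecomposable_category C \<longleftrightarrow>
    \<not> (\<exists>S T. triangulated_subcategory C S \<and> triangulated_subcategory C T \<and>
         \<not> S \<subseteq> zero_objects C \<and> \<not> T \<subseteq> zero_objects C \<and>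
         hom_orthogonal C S T \<and> hom_orthogonal C T S \<and>
         (\<forall>Z \<in> Ob C. \<exists>X \<in> S. \<exists>Y \<in> T. is_direct_sum C [X, Y] Z))"


section \<open>Cotorsion pairs\<close>

definition cotorsion_pair :: "('k, 'o, 'm, 'z) tri_cat_scheme \<Rightarrow> 'o set \<Rightarrow> 'o set \<Rightarrow> bool"
  where "cotorsion_pair C S T \<longleftrightarrow> subcategory C S \<and> subcategory C T \<and>
    hom_orthogonal C S (shift C 1 ` T) \<and> Ob C = extension_product C S (shift C 1 ` T)"

definition t_structure :: "('k, 'o, 'm, 'z) tri_cat_scheme \<Rightarrow> 'o set \<Rightarrow> 'o set \<Rightarrow> bool"
  where "t_structure C S T \<longleftrightarrow> cotorsion_pair C S T \<and> shift C 1 ` S \<subseteq> S"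

definition co_t_structure :: "('k, 'o, 'm, 'z) tri_cat_scheme \<Rightarrow> 'o set \<Rightarrow> 'o set \<Rightarrow> bool"
  where "co_t_structure C S T \<longleftrightarrow> cotorsion_pair C S T \<and> shift C (-1) ` S \<subseteq> S"

end

theory Submission
  imports Defs
begin

text \<open>
  Let \<open>(S, T)\<close> be a cotorsion pair and \<open>U = T[1]\<close>. Since \<open>Hom(S, U) = 0\<close> and \<open>S\<close> is closed under
  \<open>[-1]\<close> (respectively \<open>[1]\<close>), the Calabi--Yau duality and the sign of \<open>d\<close> give
  \<open>Hom(U, S[m]) = 0\<close> for \<open>m = 0, 1\<close> (respectively \<open>m = -1, 0, 1\<close>). The case \<open>m = 1\<close> kills the
  connecting maps of the triangles \<open>A \<rightarrow> Z \<rightarrow> B \<rightarrow> A[1]\<close> with \<open>A \<in> S\<close> and \<open>B \<in> U\<close>, so all of them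
  split. A second application of the vanishing shows that \<open>S\<close> is also closed under the opposite
  shift. Then \<open>S\<close> and \<open>{Z. Hom(Z, S) = 0}\<close> are triangulated subcategories, each being the left
  orthogonal of the other, and they decompose the category; by indecomposability one of them is
  zero. Only the zero-transfer \<open>Hom(Y, X[d]) = 0 \<Longrightarrow> Hom(X, Y) = 0\<close> of the duality is needed.
\<close>

text \<open>The zero objects, the complement of a class \<open>S\<close> and, as a double
  orthogonal, \<open>S\<close> itself all turn out to have this form, so the closure properties
  proved for it serve all three.\<close>

definition left_orth :: "('k, 'o, 'm, 'z) lin_cat_scheme \<Rightarrow> 'o set \<Rightarrow> 'o set"
  where "left_orth C T = {Z \<in> Ob C. \<forall>W \<in> T. Mor C Z W = {Zero C Z W}}"

section \<open>Linear categories\<close>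

context linear_category
begin

section \<open>Hom spaces as abelian groups and bilinearity of composition\<close>

lemma hom_module: "\<lbrakk>X \<in> Ob C; Y \<in> Ob C\<rbrakk> \<Longrightarrow> module K (Hom C X Y)"
  using hom_vectorspace by (simp add: vectorspace_def)

lemma hom_abelian_group: "\<lbrakk>X \<in> Ob C; Y \<in> Ob C\<rbrakk> \<Longrightarrow> abelian_group (Hom C X Y)"
  using hom_module by (simp add: module_def)

lemma zero_mor: "\<lbrakk>X \<in> Ob C; Y \<in> Ob C\<rbrakk> \<Longrightarrow> Zero C X Y \<in> Mor C X Y"
  by (simp add: abelian_groupE(2) hom_abelian_group)

lemma minus_mor:
  "\<lbrakk>X \<in> Ob C; Y \<in> Ob C; f \<in> Mor C X Y; g \<in> Mor C X Y\<rbrakk> \<Longrightarrow> f \<ominus>\<^bsub>Hom C X Y\<^esub> g \<in> Mor C X Y"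
  by (simp add: abelian_group.minus_closed hom_abelian_group)

lemma minus_mor_eq_zero_iff:
  "\<lbrakk>X \<in> Ob C; Y \<in> Ob C; f \<in> Mor C X Y; g \<in> Mor C X Y\<rbrakk>
   \<Longrightarrow> f \<ominus>\<^bsub>Hom C X Y\<^esub> g = Zero C X Y \<longleftrightarrow> f = g"
  by (metis abelian_group.r_neg abelian_group.a_inv_closed abelian_group.minus_eq
      abelian_group.minus_equality abelian_group.minus_minus hom_abelian_group)

lemma add_minus_cancel:
  "\<lbrakk>X \<in> Ob C; Y \<in> Ob C; f \<in> Mor C X Y; g \<in> Mor C X Y\<rbrakk>
   \<Longrightarrow> f \<oplus>\<^bsub>Hom C X Y\<^esub> (g \<ominus>\<^bsub>Hom C X Y\<^esub> f) = g"
proof -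
  assume ob: "X \<in> Ob C" "Y \<in> Ob C" and m: "f \<in> Mor C X Y" "g \<in> Mor C X Y"
  interpret H: abelian_group "Hom C X Y" using ob by (simp add: hom_abelian_group)
  show ?thesis using m by (simp add: H.minus_eq H.a_lcomm[of f g "\<ominus>\<^bsub>Hom C X Y\<^esub> f"] H.r_neg)
qed

lemma comp_mod_hom_right:
  "\<lbrakk>X \<in> Ob C; Y \<in> Ob C; Z \<in> Ob C; g \<in> Mor C Y Z\<rbrakk>
   \<Longrightarrow> mod_hom K (Hom C X Y) (Hom C X Z) (\<lambda>f. g \<cdot>\<^bsub>C\<^esub> f)"
  by (simp add: mod_hom_def mod_hom_axioms_def hom_module comp_linear_right)

lemma comp_mod_hom_left:
  "\<lbrakk>X \<in> Ob C; Y \<in> Ob C; Z \<in> Ob C; f \<in> Mor C X Y\<rbrakk>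
   \<Longrightarrow> mod_hom K (Hom C Y Z) (Hom C X Z) (\<lambda>g. g \<cdot>\<^bsub>C\<^esub> f)"
  by (simp add: mod_hom_def mod_hom_axioms_def hom_module comp_linear_left)

lemma comp_zero_right:
  "\<lbrakk>X \<in> Ob C; Y \<in> Ob C; Z \<in> Ob C; g \<in> Mor C Y Z\<rbrakk> \<Longrightarrow> g \<cdot>\<^bsub>C\<^esub> Zero C X Y = Zero C X Z"
  using mod_hom.f0_is_0[OF comp_mod_hom_right] by blast

lemma comp_zero_left:
  "\<lbrakk>X \<in> Ob C; Y \<in> Ob C; Z \<in> Ob C; f \<in> Mor C X Y\<rbrakk> \<Longrightarrow> Zero C Y Z \<cdot>\<^bsub>C\<^esub> f = Zero C X Z"
  using mod_hom.f0_is_0[OF comp_mod_hom_left] by blast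

lemma comp_minus_right:
  "\<lbrakk>X \<in> Ob C; Y \<in> Ob C; Z \<in> Ob C; g \<in> Mor C Y Z; f \<in> Mor C X Y; f' \<in> Mor C X Y\<rbrakk>
   \<Longrightarrow> g \<cdot>\<^bsub>C\<^esub> (f \<ominus>\<^bsub>Hom C X Y\<^esub> f') = g \<cdot>\<^bsub>C\<^esub> f \<ominus>\<^bsub>Hom C X Z\<^esub> g \<cdot>\<^bsub>C\<^esub> f'"
  using mod_hom.f_minus[OF comp_mod_hom_right] by blast

lemma comp_minus_left:
  "\<lbrakk>X \<in> Ob C; Y \<in> Ob C; Z \<in> Ob C; f \<in> Mor C X Y; g \<in> Mor C Y Z; g' \<in> Mor C Y Z\<rbrakk>
   \<Longrightarrow> (g \<ominus>\<^bsub>Hom C Y Z\<^esub> g') \<cdot>\<^bsub>C\<^esub> f = g \<cdot>\<^bsub>C\<^esub> f \<ominus>\<^bsub>Hom C X Z\<^esub> g' \<cdot>\<^bsub>C\<^esub> f"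
  using mod_hom.f_minus[OF comp_mod_hom_left] by blast

section \<open>Zero objects and binary direct sums\<close>

text \<open>Every map into or out of \<open>Z\<close> is a composite with \<open>Id C Z\<close>, so
  it vanishes once the identity does. The test by a single equation is what shifts visibly
  preserve.\<close>

lemma zero_objects_iff_id: "Z \<in> zero_objects C \<longleftrightarrow> Z \<in> Ob C \<and> Id C Z = Zero C Z Z"
proof
  assume "Z \<in> zero_objects C"
  then show "Z \<in> Ob C \<and> Id C Z = Zero C Z Z"
    using id_closed unfolding zero_objects_def by blast
next
  assume Z: "Z \<in> Ob C \<and> Id C Z = Zero C Z Z"
  have "f = Zero C X Z" if "X \<in> Ob C" "f \<in> Mor C X Z" for X f
    using Z that by (metis comp_id_left comp_zero_left)
  moreover have "f = Zero C Z X" if "X \<in> Ob C" "f \<in> Mor C Z X" for X f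
    using Z that by (metis comp_id_right comp_zero_right)
  ultimately show "Z \<in> zero_objects C"
    using Z zero_mor unfolding zero_objects_def by blast
qed

lemma is_direct_sum_pairE:
  assumes "is_direct_sum C [A, B] Z"
  obtains i p j q where "A \<in> Ob C" "B \<in> Ob C" "Z \<in> Ob C"
    "i \<in> Mor C A Z" "p \<in> Mor C Z A" "j \<in> Mor C B Z" "q \<in> Mor C Z B"
    "p \<cdot>\<^bsub>C\<^esub> i = Id C A" "q \<cdot>\<^bsub>C\<^esub> j = Id C B"
    "i \<cdot>\<^bsub>C\<^esub> p \<oplus>\<^bsub>Hom C Z Z\<^esub> j \<cdot>\<^bsub>C\<^esub> q = Id C Z"
proof -
  have ob: "A \<in> Ob C" "B \<in> Ob C" "Z \<in> Ob C" using assms by (auto simp: is_direct_sum_def)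
  interpret Z: abelian_group "Hom C Z Z" using ob by (simp add: hom_abelian_group)
  obtain \<iota> \<pi> where mor: "\<forall>i < length [A, B]. \<iota> i \<in> Mor C ([A, B] ! i) Z \<and> \<pi> i \<in> Mor C Z ([A, B] ! i)"
    and ort: "\<forall>i < length [A, B]. \<forall>j < length [A, B].
        \<pi> i \<cdot>\<^bsub>C\<^esub> \<iota> j = (if i = j then Id C ([A, B] ! i) else Zero C ([A, B] ! j) ([A, B] ! i))"
    and sum: "(\<Oplus>\<^bsub>Hom C Z Z\<^esub> i \<in> {..<length [A, B]}. \<iota> i \<cdot>\<^bsub>C\<^esub> \<pi> i) = Id C Z"
    using assms unfolding is_direct_sum_def by blast
  have m: "\<iota> 0 \<in> Mor C A Z" "\<pi> 0 \<in> Mor C Z A" "\<iota> 1 \<in> Mor C B Z" "\<pi> 1 \<in> Mor C Z B"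
    using mor[rule_format, of 0] mor[rule_format, of 1] by auto
  then have c: "\<iota> 0 \<cdot>\<^bsub>C\<^esub> \<pi> 0 \<in> Mor C Z Z" "\<iota> (Suc 0) \<cdot>\<^bsub>C\<^esub> \<pi> (Suc 0) \<in> Mor C Z Z"
    using comp_closed ob by (metis, metis One_nat_def)
  have "\<iota> 0 \<cdot>\<^bsub>C\<^esub> \<pi> 0 \<oplus>\<^bsub>Hom C Z Z\<^esub> \<iota> 1 \<cdot>\<^bsub>C\<^esub> \<pi> 1 = Id C Z"
    using sum c by (simp add: lessThan_Suc Z.a_comm)
  moreover have "\<pi> 0 \<cdot>\<^bsub>C\<^esub> \<iota> 0 = Id C A" "\<pi> 1 \<cdot>\<^bsub>C\<^esub> \<iota> 1 = Id C B"
    using ort[rule_format, of 0 0] ort[rule_format, of 1 1] by auto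
  ultimately show ?thesis using that ob m by blast
qed

lemma is_direct_sum_pairI:
  assumes ob: "A \<in> Ob C" "B \<in> Ob C" "Z \<in> Ob C"
    and m: "i \<in> Mor C A Z" "p \<in> Mor C Z A" "j \<in> Mor C B Z" "q \<in> Mor C Z B"
    and eq: "p \<cdot>\<^bsub>C\<^esub> i = Id C A" "q \<cdot>\<^bsub>C\<^esub> j = Id C B" "p \<cdot>\<^bsub>C\<^esub> j = Zero C B A" "q \<cdot>\<^bsub>C\<^esub> i = Zero C A B"
    and sum: "i \<cdot>\<^bsub>C\<^esub> p \<oplus>\<^bsub>Hom C Z Z\<^esub> j \<cdot>\<^bsub>C\<^esub> q = Id C Z"
  shows "is_direct_sum C [A, B] Z"
proof -
  interpret Z: abelian_group "Hom C Z Z" using ob by (simp add: hom_abelian_group)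
  have c: "i \<cdot>\<^bsub>C\<^esub> p \<in> Mor C Z Z" "j \<cdot>\<^bsub>C\<^esub> q \<in> Mor C Z Z"
    using comp_closed ob m by metis+
  define \<iota> \<pi> where "\<iota> = (\<lambda>n :: nat. if n = 0 then i else j)" and "\<pi> = (\<lambda>n :: nat. if n = 0 then p else q)"
  have "(\<Oplus>\<^bsub>Hom C Z Z\<^esub> n \<in> {..<length [A, B]}. \<iota> n \<cdot>\<^bsub>C\<^esub> \<pi> n) = Id C Z"
    using sum c by (simp add: \<iota>_def \<pi>_def lessThan_Suc Z.a_comm)
  moreover have "\<forall>n < length [A, B]. \<iota> n \<in> Mor C ([A, B] ! n) Z \<and> \<pi> n \<in> Mor C Z ([A, B] ! n)"
    using m by (auto simp: \<iota>_def \<pi>_def less_Suc_eq)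
  moreover have "\<forall>n < length [A, B]. \<forall>k < length [A, B].
        \<pi> n \<cdot>\<^bsub>C\<^esub> \<iota> k = (if n = k then Id C ([A, B] ! n) else Zero C ([A, B] ! k) ([A, B] ! n))"
    using eq by (auto simp: \<iota>_def \<pi>_def less_Suc_eq)
  ultimately show ?thesis using ob unfolding is_direct_sum_def
    by (intro conjI exI[of _ \<iota>] exI[of _ \<pi>]) auto
qed

text \<open>The projection to a zero object vanishes, so its term drops out of the decomposition of
  \<open>Id C Z\<close>, and the remaining inclusion and projection are mutually inverse.\<close>

lemma direct_sum_right_zero:
  assumes "is_direct_sum C [A, B] Z" "B \<in> zero_objects C"
  shows "isomorphic C A Z"
proof -
  obtain i p j q where ds: "A \<in> Ob C" "B \<in> Ob C" "Z \<in> Ob C"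
    "i \<in> Mor C A Z" "p \<in> Mor C Z A" "j \<in> Mor C B Z" "q \<in> Mor C Z B"
    "p \<cdot>\<^bsub>C\<^esub> i = Id C A" "i \<cdot>\<^bsub>C\<^esub> p \<oplus>\<^bsub>Hom C Z Z\<^esub> j \<cdot>\<^bsub>C\<^esub> q = Id C Z"
    using assms(1) by (elim is_direct_sum_pairE)
  have "q = Zero C Z B" using assms(2) ds by (auto simp: zero_objects_def)
  then have "j \<cdot>\<^bsub>C\<^esub> q = Zero C Z Z" using ds comp_zero_right by metis
  moreover have "i \<cdot>\<^bsub>C\<^esub> p \<in> Mor C Z Z" using ds comp_closed by metis
  ultimately have "i \<cdot>\<^bsub>C\<^esub> p = Id C Z"
    using ds by (simp add: hom_abelian_group abelian_monoid.r_zero abelian_group.axioms(1))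
  then show ?thesis using ds unfolding isomorphic_def iso_mor_def by blast
qed

lemma direct_sum_left_zero:
  assumes "is_direct_sum C [A, B] Z" "A \<in> zero_objects C"
  shows "isomorphic C B Z"
proof -
  obtain i p j q where ds: "A \<in> Ob C" "B \<in> Ob C" "Z \<in> Ob C"
    "i \<in> Mor C A Z" "p \<in> Mor C Z A" "j \<in> Mor C B Z" "q \<in> Mor C Z B"
    "q \<cdot>\<^bsub>C\<^esub> j = Id C B" "i \<cdot>\<^bsub>C\<^esub> p \<oplus>\<^bsub>Hom C Z Z\<^esub> j \<cdot>\<^bsub>C\<^esub> q = Id C Z"
    using assms(1) by (elim is_direct_sum_pairE)
  have "p = Zero C Z A" using assms(2) ds by (auto simp: zero_objects_def)
  then have "i \<cdot>\<^bsub>C\<^esub> p = Zero C Z Z" using ds comp_zero_right by metis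
  moreover have "j \<cdot>\<^bsub>C\<^esub> q \<in> Mor C Z Z" using ds comp_closed by metis
  ultimately have "j \<cdot>\<^bsub>C\<^esub> q = Id C Z"
    using ds by (simp add: hom_abelian_group abelian_monoid.l_zero abelian_group.axioms(1))
  then show ?thesis using ds unfolding isomorphic_def iso_mor_def by blast
qed

section \<open>Left orthogonals and closure of subcategories\<close>

lemma left_orthI:
  "\<lbrakk>T \<subseteq> Ob C; Z \<in> Ob C; \<And>W f. \<lbrakk>W \<in> T; f \<in> Mor C Z W\<rbrakk> \<Longrightarrow> f = Zero C Z W\<rbrakk> \<Longrightarrow> Z \<in> left_orth C T"
  using zero_mor unfolding left_orth_def by blast

lemma left_orthD:
  "\<lbrakk>Z \<in> left_orth C T; W \<in> T; f \<in> Mor C Z W\<rbrakk> \<Longrightarrow> f = Zero C Z W"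
  unfolding left_orth_def by blast

text \<open>A map \<open>f\<close> out of the retract \<open>Y\<close> equals
  \<open>(f p) i\<close>, and \<open>f p\<close> starts at \<open>X\<close>, hence vanishes. Closure
  under isomorphisms and under direct summands are both instances.\<close>

lemma left_orth_retract:
  assumes "T \<subseteq> Ob C" "X \<in> left_orth C T" "Y \<in> Ob C"
    and "i \<in> Mor C Y X" "p \<in> Mor C X Y" "p \<cdot>\<^bsub>C\<^esub> i = Id C Y"
  shows "Y \<in> left_orth C T"
proof (rule left_orthI)
  fix W f assume W: "W \<in> T" "f \<in> Mor C Y W"
  have ob: "X \<in> Ob C" "W \<in> Ob C" using assms W by (auto simp: left_orth_def)
  have "f = f \<cdot>\<^bsub>C\<^esub> (p \<cdot>\<^bsub>C\<^esub> i)" using W ob assms comp_id_right by metis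
  also have "\<dots> = (f \<cdot>\<^bsub>C\<^esub> p) \<cdot>\<^bsub>C\<^esub> i" using W ob assms comp_assoc by metis
  also have "f \<cdot>\<^bsub>C\<^esub> p = Zero C X W" using left_orthD assms W ob comp_closed by metis
  also have "Zero C X W \<cdot>\<^bsub>C\<^esub> i = Zero C Y W" using assms ob comp_zero_left by metis
  finally show "f = Zero C Y W" .
qed (use assms in auto)

lemma subcategory_isomorphic:
  "\<lbrakk>subcategory C S; X \<in> S; Y \<in> Ob C; isomorphic C X Y\<rbrakk> \<Longrightarrow> Y \<in> S"
  unfolding subcategory_def by blast

text \<open>For finite direct sums, a map \<open>f\<close> is expanded along the decomposition of
  \<open>Id C Z\<close>; each term contains a composite of \<open>f\<close> with an inclusion, which
  starts at a summand and so is zero.\<close>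

lemma subcategory_left_orth:
  assumes T: "T \<subseteq> Ob C"
  shows "subcategory C (left_orth C T)"
  unfolding subcategory_def
proof (intro conjI ballI allI impI)
  show "left_orth C T \<subseteq> Ob C" by (auto simp: left_orth_def)
next
  fix X Y assume "X \<in> left_orth C T" "Y \<in> Ob C" "isomorphic C X Y"
  then show "Y \<in> left_orth C T"
    using left_orth_retract[OF T] unfolding isomorphic_def iso_mor_def by blast
next
  fix Xs Z assume a: "set Xs \<subseteq> left_orth C T \<and> is_direct_sum C Xs Z"
  then have Z: "Z \<in> Ob C" and Xs: "set Xs \<subseteq> Ob C" by (auto simp: is_direct_sum_def)
  obtain \<iota> \<pi> where mor: "\<And>i. i < length Xs \<Longrightarrow> \<iota> i \<in> Mor C (Xs ! i) Z \<and> \<pi> i \<in> Mor C Z (Xs ! i)"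
    and sum: "(\<Oplus>\<^bsub>Hom C Z Z\<^esub> i \<in> {..<length Xs}. \<iota> i \<cdot>\<^bsub>C\<^esub> \<pi> i) = Id C Z"
    using a unfolding is_direct_sum_def by blast
  interpret Z: abelian_group "Hom C Z Z" using Z by (simp add: hom_abelian_group)
  show "Z \<in> left_orth C T"
  proof (rule left_orthI)
    fix W f assume W: "W \<in> T" and f: "f \<in> Mor C Z W"
    have W': "W \<in> Ob C" using W T by auto
    interpret W: abelian_group "Hom C Z W" using Z W' by (simp add: hom_abelian_group)
    interpret f: mod_hom K "Hom C Z Z" "Hom C Z W" "\<lambda>h. f \<cdot>\<^bsub>C\<^esub> h"
      using comp_mod_hom_right Z W' f by simp
    have term_mor: "\<iota> i \<cdot>\<^bsub>C\<^esub> \<pi> i \<in> Mor C Z Z" if "i < length Xs" for i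
      using mor[OF that] that Xs Z comp_closed nth_mem by blast
    have term_zero: "f \<cdot>\<^bsub>C\<^esub> \<iota> i \<cdot>\<^bsub>C\<^esub> \<pi> i = Zero C Z W" if i: "i < length Xs" for i
    proof -
      have Xi: "Xs ! i \<in> left_orth C T" "Xs ! i \<in> Ob C" using i a Xs nth_mem by blast+
      have "f \<cdot>\<^bsub>C\<^esub> \<iota> i \<in> Mor C (Xs ! i) W" using mor[OF i] Xi Z W' f comp_closed by blast
      then have "f \<cdot>\<^bsub>C\<^esub> \<iota> i = Zero C (Xs ! i) W" using left_orthD[OF Xi(1) W] by blast
      then show ?thesis
        using mor[OF i] Xi Z W' f comp_assoc comp_zero_left by metis
    qed
    \<comment> \<open>Composition with \<open>f\<close> is additive only for two terms, so the sum
      is built up one term at a time; the bound on \<open>n\<close> keeps every index inside the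
      list.\<close>
    have "n \<le> length Xs \<Longrightarrow> f \<cdot>\<^bsub>C\<^esub> (\<Oplus>\<^bsub>Hom C Z Z\<^esub> i \<in> {..<n}. \<iota> i \<cdot>\<^bsub>C\<^esub> \<pi> i) = Zero C Z W" for n
    proof (induction n)
      case 0
      then show ?case using f.f0_is_0 by simp
    next
      case (Suc n)
      have "(\<Oplus>\<^bsub>Hom C Z Z\<^esub> i \<in> {..<n}. \<iota> i \<cdot>\<^bsub>C\<^esub> \<pi> i) \<in> Mor C Z Z"
        using Suc.prems term_mor by (intro Z.finsum_closed) auto
      moreover have "(\<Oplus>\<^bsub>Hom C Z Z\<^esub> i \<in> {..<Suc n}. \<iota> i \<cdot>\<^bsub>C\<^esub> \<pi> i)
        = \<iota> n \<cdot>\<^bsub>C\<^esub> \<pi> n \<oplus>\<^bsub>Hom C Z Z\<^esub> (\<Oplus>\<^bsub>Hom C Z Z\<^esub> i \<in> {..<n}. \<iota> i \<cdot>\<^bsub>C\<^esub> \<pi> i)"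
        using Suc.prems term_mor by (simp add: lessThan_Suc)
      ultimately show ?case
        using Suc term_mor[of n] term_zero[of n] f.f_add by simp
    qed
    from this[of "length Xs"] have "f \<cdot>\<^bsub>C\<^esub> Id C Z = Zero C Z W" using sum by simp
    then show "f = Zero C Z W" using f Z W' comp_id_right by metis
  qed (use T Z in auto)
next
  fix X Y Z assume "Z \<in> left_orth C T" "is_direct_sum C [X, Y] Z"
  then show "X \<in> left_orth C T"
    using left_orth_retract[OF T] by (elim is_direct_sum_pairE) blast
qed

text \<open>If all maps out of \<open>Z\<close> vanish, so does its identity. The zero objects
  thereby inherit closure from the general result on left orthogonals.\<close>

lemma zero_objects_eq_left_orth: "zero_objects C = left_orth C (Ob C)"
proof
  show "zero_objects C \<subseteq> left_orth C (Ob C)"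
    by (auto simp: zero_objects_def left_orth_def)
  show "left_orth C (Ob C) \<subseteq> zero_objects C"
    using zero_objects_iff_id id_closed unfolding left_orth_def by blast
qed

text \<open>A zero object is a direct sum of the empty list: the empty sum of endomorphisms is zero,
  which is its identity.\<close>

lemma zero_objects_subset: "subcategory C S \<Longrightarrow> zero_objects C \<subseteq> S"
proof
  fix Z assume S: "subcategory C S" and Z: "Z \<in> zero_objects C"
  have ob: "Z \<in> Ob C" "Id C Z = Zero C Z Z" using Z zero_objects_iff_id by blast+
  interpret Z: abelian_group "Hom C Z Z" using ob by (simp add: hom_abelian_group)
  have "is_direct_sum C [] Z" using ob by (simp add: is_direct_sum_def)
  then show "Z \<in> S" using S unfolding subcategory_def by (metis empty_set empty_subsetI)
qed

lemma subcategory_Ob: "subcategory C (Ob C)"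
  unfolding subcategory_def is_direct_sum_def by auto

end


section \<open>Triangulated categories\<close>

context triangulated_category
begin

section \<open>Shifts and the existence of zero objects\<close>

lemma shift_mod_hom:
  "\<lbrakk>X \<in> Ob C; Y \<in> Ob C\<rbrakk>
   \<Longrightarrow> mod_hom K (Hom C X Y) (Hom C (shift C n X) (shift C n Y)) (shift_mor C n)"
  by (simp add: mod_hom_def mod_hom_axioms_def hom_module shift_closed shift_mor_linear)

lemma shift_mor_closed:
  "\<lbrakk>X \<in> Ob C; Y \<in> Ob C; f \<in> Mor C X Y\<rbrakk> \<Longrightarrow> shift_mor C n f \<in> Mor C (shift C n X) (shift C n Y)"
  using mod_hom.f_im[OF shift_mod_hom] by blast

lemma shift_mor_Zero:
  "\<lbrakk>X \<in> Ob C; Y \<in> Ob C\<rbrakk> \<Longrightarrow> shift_mor C n (Zero C X Y) = Zero C (shift C n X) (shift C n Y)"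
  using mod_hom.f0_is_0[OF shift_mod_hom] by blast

lemma shift_minus: "X \<in> Ob C \<Longrightarrow> shift C (- n) (shift C n X) = X"
  and shift_minus': "X \<in> Ob C \<Longrightarrow> shift C n (shift C (- n) X) = X"
  by (simp_all add: shift_add shift_zero)

text \<open>Shifting by \<open>-n\<close> brings a map back to the vanishing Hom space, and shifting
  by \<open>n\<close> recovers it.\<close>

lemma shift_hom_zero:
  assumes ob: "X \<in> Ob C" "Y \<in> Ob C" and zero: "Mor C X Y = {Zero C X Y}"
  shows "Mor C (shift C n X) (shift C n Y) = {Zero C (shift C n X) (shift C n Y)}"
proof -
  have "f = Zero C (shift C n X) (shift C n Y)" if f: "f \<in> Mor C (shift C n X) (shift C n Y)" for f
  proof -
    have "shift_mor C (- n) f \<in> Mor C X Y"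
      using shift_mor_closed[OF _ _ f, of "- n"] ob by (simp add: shift_closed shift_minus)
    then have "shift_mor C n (shift_mor C (- n) f) = Zero C (shift C n X) (shift C n Y)"
      using zero ob shift_mor_Zero by simp
    then show ?thesis
      using f ob by (simp add: shift_mor_add[OF _ _ f] shift_mor_zero[OF _ _ f] shift_closed)
  qed
  then show ?thesis using zero_mor ob shift_closed by blast
qed

text \<open>This is the adjunction between \<open>[n]\<close> and \<open>[-n]\<close>, restricted to
  the vanishing of Hom spaces.\<close>

lemma shift_hom_zero_iff:
  assumes ob: "X \<in> Ob C" "Y \<in> Ob C"
  shows "Mor C (shift C n X) Y = {Zero C (shift C n X) Y}
    \<longleftrightarrow> Mor C X (shift C (- n) Y) = {Zero C X (shift C (- n) Y)}"
  using shift_hom_zero[of "shift C n X" Y "- n"] shift_hom_zero[of X "shift C (- n) Y" n] ob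
  by (auto simp: shift_closed shift_minus shift_minus')

lemma shift_zero_objects:
  assumes "Z \<in> zero_objects C" shows "shift C n Z \<in> zero_objects C"
  using assms shift_mor_id[of Z n] shift_mor_Zero[of Z Z n] shift_closed
  by (auto simp: zero_objects_iff_id)

lemma shift_isomorphic:
  assumes ob: "X \<in> Ob C" "Y \<in> Ob C" and iso: "isomorphic C X Y"
  shows "isomorphic C (shift C n X) (shift C n Y)"
proof -
  obtain f g where fg: "f \<in> Mor C X Y" "g \<in> Mor C Y X" "g \<cdot>\<^bsub>C\<^esub> f = Id C X" "f \<cdot>\<^bsub>C\<^esub> g = Id C Y"
    using iso unfolding isomorphic_def iso_mor_def by blast
  then have "shift_mor C n g \<cdot>\<^bsub>C\<^esub> shift_mor C n f = Id C (shift C n X)"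
    "shift_mor C n f \<cdot>\<^bsub>C\<^esub> shift_mor C n g = Id C (shift C n Y)"
    using ob shift_mor_comp shift_mor_id by metis+
  then show ?thesis
    using fg ob shift_mor_closed unfolding isomorphic_def iso_mor_def by blast
qed

lemma zero_object_exists: "\<exists>Z. Z \<in> zero_objects C"
proof -
  obtain Z where "is_direct_sum C [] Z" using direct_sum_exists[of "[]"] by auto
  then have "Z \<in> Ob C" "(\<Oplus>\<^bsub>Hom C Z Z\<^esub> i \<in> {}. undefined i) = Id C Z"
    by (auto simp: is_direct_sum_def abelian_monoid.finsum_empty abelian_group.axioms(1) hom_abelian_group)
  then have "Z \<in> zero_objects C"
    by (simp add: zero_objects_iff_id abelian_monoid.finsum_empty abelian_group.axioms(1) hom_abelian_group)
  then show ?thesis ..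
qed

section \<open>Distinguished triangles\<close>

lemma dist_triD:
  assumes "(X, Y, Z, f, g, h) \<in> dist_tri C"
  shows "X \<in> Ob C" "Y \<in> Ob C" "Z \<in> Ob C"
    "f \<in> Mor C X Y" "g \<in> Mor C Y Z" "h \<in> Mor C Z (shift C 1 X)"
  using assms dist_triangles unfolding triangles_def by auto

lemma dist_tri_rotate:
  assumes "(X, Y, Z, f, g, h) \<in> dist_tri C"
  shows "(Y, Z, shift C 1 X, g, h, \<ominus>\<^bsub>Hom C (shift C 1 X) (shift C 1 Y)\<^esub> shift_mor C 1 f) \<in> dist_tri C"
  using assms TR2 dist_triangles by blast

text \<open>It rotates to the triangle on \<open>Id C W\<close> whose third object is the zero
  object \<open>N[1]\<close>. The sign introduced by rotation is harmless, since the map it affects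
  is zero.\<close>

lemma dist_tri_zero_left:
  assumes N: "N \<in> zero_objects C" and W: "W \<in> Ob C"
  shows "(N, W, W, Zero C N W, Id C W, Zero C W (shift C 1 N)) \<in> dist_tri C"
proof -
  have ob: "N \<in> Ob C" "shift C 1 N \<in> Ob C" "shift C 1 W \<in> Ob C"
    using N W shift_closed zero_objects_iff_id by blast+
  have "\<ominus>\<^bsub>Hom C (shift C 1 N) (shift C 1 W)\<^esub> shift_mor C 1 (Zero C N W) = Zero C (shift C 1 N) (shift C 1 W)"
    using N W ob
    by (metis abelian_group.minus_equality abelian_group.axioms(1) abelian_monoid.l_zero hom_abelian_group shift_mor_Zero zero_mor)
  moreover have "(W, W, shift C 1 N, Id C W, Zero C W (shift C 1 N), Zero C (shift C 1 N) (shift C 1 W)) \<in> dist_tri C"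
    using TR1_id shift_zero_objects N W by blast
  moreover have "(N, W, W, Zero C N W, Id C W, Zero C W (shift C 1 N)) \<in> triangles C"
    using N W ob by (auto simp: triangles_def zero_mor id_closed)
  ultimately show ?thesis using TR2 by simp
qed

lemma dist_tri_comp_zero:
  assumes tri: "(X, Y, Z, f, g, h) \<in> dist_tri C"
  shows "g \<cdot>\<^bsub>C\<^esub> f = Zero C X Z"
proof -
  note t = dist_triD[OF tri]
  obtain N where N: "N \<in> zero_objects C" "N \<in> Ob C"
    using zero_object_exists zero_objects_iff_id by blast
  \<comment> \<open>The pair \<open>(Id, f)\<close> extends to a morphism from the triangle of
    \<open>Id C X\<close> to the given one, so \<open>g f\<close> factors through the zero object
    \<open>N\<close>.\<close>
  obtain c where c: "c \<in> Mor C N Z" "c \<cdot>\<^bsub>C\<^esub> Zero C X N = g \<cdot>\<^bsub>C\<^esub> f"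
    using TR3[OF TR1_id[OF t(1) N(1)] tri id_closed[OF t(1)] t(4)] by blast
  then show ?thesis using comp_zero_right[OF t(1) N(2) t(3)] by simp
qed

text \<open>The condition on \<open>b\<close> says that the maps to \<open>N\<close> and to
  \<open>W\<close> form a commuting square towards the triangle of \<open>N\<close>,
  \<open>W\<close>, \<open>W\<close> with \<open>N\<close> zero; the third component of the induced
  morphism is the factorization.\<close>

lemma dist_tri_weak_cokernel:
  assumes tri: "(X, Y, Z, f, g, h) \<in> dist_tri C" and W: "W \<in> Ob C"
    and b: "b \<in> Mor C Y W" "b \<cdot>\<^bsub>C\<^esub> f = Zero C X W"
  obtains c where "c \<in> Mor C Z W" "c \<cdot>\<^bsub>C\<^esub> g = b"
proof -
  note t = dist_triD[OF tri]
  obtain N where N: "N \<in> zero_objects C" "N \<in> Ob C"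
    using zero_object_exists zero_objects_iff_id by blast
  have "b \<cdot>\<^bsub>C\<^esub> f = Zero C N W \<cdot>\<^bsub>C\<^esub> Zero C X N"
    using b t N W comp_zero_left zero_mor by metis
  then obtain c where "c \<in> Mor C Z W" "c \<cdot>\<^bsub>C\<^esub> g = Id C W \<cdot>\<^bsub>C\<^esub> b"
    using TR3[OF tri dist_tri_zero_left[OF N(1) W] zero_mor[OF t(1) N(2)] b(1)] by blast
  then show ?thesis using that comp_id_left b W t by metis
qed

text \<open>A zero connecting map makes \<open>v\<close> an epimorphism and \<open>u\<close> a split
  monomorphism. With a retraction \<open>r\<close> of \<open>u\<close>, the complement
  \<open>Id - u r\<close> factors through \<open>v\<close>, and the factor \<open>s\<close> is the
  second inclusion.\<close>

lemma dist_tri_split: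
  assumes tri: "(X, Z, Y, u, v, Zero C Y (shift C 1 X)) \<in> dist_tri C"
  shows "is_direct_sum C [X, Y] Z"
proof -
  note t = dist_triD[OF tri]
  have sob: "shift C 1 X \<in> Ob C" "shift C 1 Z \<in> Ob C" "shift C (- 1) (shift C 1 X) = X"
    "shift C (- 1) (shift C 1 Z) = Z"
    using t shift_closed shift_minus by auto
  note tri1 = dist_tri_rotate[OF tri]
  note tri2 = dist_tri_rotate[OF tri1]
  have vu: "v \<cdot>\<^bsub>C\<^esub> u = Zero C X Y" using dist_tri_comp_zero[OF tri] .
  \<comment> \<open>\<open>v\<close> is an epimorphism: the difference \<open>a - b\<close> is
    killed by \<open>v\<close>, so by the rotated triangle it factors through the connecting map,
    which is zero.\<close>
  have from_Y: "a = b" if ab: "W \<in> Ob C" "a \<in> Mor C Y W" "b \<in> Mor C Y W" "a \<cdot>\<^bsub>C\<^esub> v = b \<cdot>\<^bsub>C\<^esub> v" for W a b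
  proof -
    have m: "a \<ominus>\<^bsub>Hom C Y W\<^esub> b \<in> Mor C Y W" using ab t minus_mor by blast
    have "a \<cdot>\<^bsub>C\<^esub> v \<in> Mor C Z W" using ab t comp_closed by metis
    then have "(a \<ominus>\<^bsub>Hom C Y W\<^esub> b) \<cdot>\<^bsub>C\<^esub> v = Zero C Z W"
      using ab t comp_minus_left[of Z Y W v a b] minus_mor_eq_zero_iff by simp
    then obtain c where c: "c \<in> Mor C (shift C 1 X) W"
      "c \<cdot>\<^bsub>C\<^esub> Zero C Y (shift C 1 X) = a \<ominus>\<^bsub>Hom C Y W\<^esub> b"
      using dist_tri_weak_cokernel[OF tri1 ab(1) m] by blast
    have "a \<ominus>\<^bsub>Hom C Y W\<^esub> b = Zero C Y W" using c comp_zero_right sob t ab by metis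
    then show ?thesis using ab t minus_mor_eq_zero_iff by blast
  qed
  \<comment> \<open>The retraction is found one degree up. In the twice rotated triangle,
    \<open>Id C (shift C 1 X)\<close> kills the zero map and so factors through
    \<open>-u[1]\<close>; \<open>c'\<close> absorbs the sign, and shifting by \<open>-1\<close>
    gives \<open>r\<close>.\<close>
  have "Id C (shift C 1 X) \<cdot>\<^bsub>C\<^esub> Zero C Y (shift C 1 X) = Zero C Y (shift C 1 X)"
    using comp_zero_right id_closed t sob by blast
  then obtain c where c: "c \<in> Mor C (shift C 1 Z) (shift C 1 X)"
    "c \<cdot>\<^bsub>C\<^esub> (\<ominus>\<^bsub>Hom C (shift C 1 X) (shift C 1 Z)\<^esub> shift_mor C 1 u) = Id C (shift C 1 X)"
    using dist_tri_weak_cokernel[OF tri2 sob(1) id_closed[OF sob(1)]] by blast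
  have su: "shift_mor C 1 u \<in> Mor C (shift C 1 X) (shift C 1 Z)" using t shift_mor_closed by blast
  define c' where "c' = \<ominus>\<^bsub>Hom C (shift C 1 Z) (shift C 1 X)\<^esub> c"
  have c': "c' \<in> Mor C (shift C 1 Z) (shift C 1 X)"
    unfolding c'_def using c sob hom_abelian_group abelian_group.a_inv_closed by metis
  have c'u: "c' \<cdot>\<^bsub>C\<^esub> shift_mor C 1 u = Id C (shift C 1 X)"
    using c mod_hom.f_neg[OF comp_mod_hom_right[OF sob(1,2,1) c(1)] su]
      mod_hom.f_neg[OF comp_mod_hom_left[OF sob(1,2,1) su] c(1)]
    by (simp add: c'_def)
  define r where "r = shift_mor C (- 1) c'"
  have r: "r \<in> Mor C Z X"
    using shift_mor_closed[OF sob(2,1) c', of "-1"] sob by (simp add: r_def)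
  have ru: "r \<cdot>\<^bsub>C\<^esub> u = Id C X"
  proof -
    have "shift_mor C (- 1) (c' \<cdot>\<^bsub>C\<^esub> shift_mor C 1 u) = r \<cdot>\<^bsub>C\<^esub> shift_mor C (- 1) (shift_mor C 1 u)"
      unfolding r_def using shift_mor_comp[OF sob(1,2,1) su c'] .
    moreover have "shift_mor C (- 1) (shift_mor C 1 u) = u"
      using t by (simp add: shift_mor_add[OF _ _ t(4)] shift_mor_zero[OF _ _ t(4)])
    moreover have "shift_mor C (- 1) (Id C (shift C 1 X)) = Id C X"
      using shift_mor_id[OF sob(1), of "-1"] sob by simp
    ultimately show ?thesis using c'u by simp
  qed
  have ur: "u \<cdot>\<^bsub>C\<^esub> r \<in> Mor C Z Z" using comp_closed t r by metis
  define e where "e = Id C Z \<ominus>\<^bsub>Hom C Z Z\<^esub> u \<cdot>\<^bsub>C\<^esub> r"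
  have e: "e \<in> Mor C Z Z" unfolding e_def using minus_mor t ur id_closed by blast
  have uru: "(u \<cdot>\<^bsub>C\<^esub> r) \<cdot>\<^bsub>C\<^esub> u = u" using comp_assoc t r ru comp_id_right by metis
  have "e \<cdot>\<^bsub>C\<^esub> u = Zero C X Z"
    unfolding e_def using comp_minus_left[OF t(1,2,2,4) id_closed[OF t(2)] ur] uru
      minus_mor_eq_zero_iff[OF t(1,2,4,4)] comp_id_left[OF t(1,2,4)] by simp
  then obtain s where s: "s \<in> Mor C Y Z" "s \<cdot>\<^bsub>C\<^esub> v = e"
    using dist_tri_weak_cokernel[OF tri t(2) e] by blast
  have "v \<cdot>\<^bsub>C\<^esub> u \<cdot>\<^bsub>C\<^esub> r = Zero C Z Y"
    using comp_assoc[OF t(2,1,2,3) r t(4,5)] vu comp_zero_left[OF t(2,1,3) r] by simp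
  then have "v \<cdot>\<^bsub>C\<^esub> e = v \<ominus>\<^bsub>Hom C Z Y\<^esub> Zero C Z Y"
    unfolding e_def using comp_minus_right[OF t(2,2,3,5) id_closed[OF t(2)] ur] comp_id_right[OF t(2,3,5)]
    by simp
  then have "v \<cdot>\<^bsub>C\<^esub> e = v"
    using add_minus_cancel[OF t(2,3) zero_mor[OF t(2,3)] t(5)] minus_mor[OF t(2,3,5) zero_mor[OF t(2,3)]]
    by (simp add: t abelian_monoid.l_zero abelian_group.axioms(1) hom_abelian_group)
  then have "(v \<cdot>\<^bsub>C\<^esub> s) \<cdot>\<^bsub>C\<^esub> v = Id C Y \<cdot>\<^bsub>C\<^esub> v"
    using s t comp_assoc comp_id_left by metis
  moreover have "v \<cdot>\<^bsub>C\<^esub> s \<in> Mor C Y Y" using s t comp_closed by metis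
  \<comment> \<open>The epimorphism \<open>v\<close> is cancelled on the right; \<open>rs\<close>
    below follows likewise from \<open>r e = 0\<close>.\<close>
  ultimately have vs: "v \<cdot>\<^bsub>C\<^esub> s = Id C Y" using from_Y t id_closed by blast
  have "r \<cdot>\<^bsub>C\<^esub> u \<cdot>\<^bsub>C\<^esub> r = r" using comp_assoc[OF t(2,1,2,1) r t(4) r] ru comp_id_left t r by simp
  then have "r \<cdot>\<^bsub>C\<^esub> e = Zero C Z X"
    unfolding e_def using comp_minus_right[OF t(2,2,1) r id_closed[OF t(2)] ur] comp_id_right[OF t(2,1) r]
      minus_mor_eq_zero_iff[OF t(2,1) r r] by simp
  then have "(r \<cdot>\<^bsub>C\<^esub> s) \<cdot>\<^bsub>C\<^esub> v = Zero C Y X \<cdot>\<^bsub>C\<^esub> v"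
    using s t r comp_assoc comp_zero_left by metis
  moreover have "r \<cdot>\<^bsub>C\<^esub> s \<in> Mor C Y X" using s t r comp_closed by metis
  ultimately have rs: "r \<cdot>\<^bsub>C\<^esub> s = Zero C Y X" using from_Y t zero_mor by blast
  have "u \<cdot>\<^bsub>C\<^esub> r \<oplus>\<^bsub>Hom C Z Z\<^esub> s \<cdot>\<^bsub>C\<^esub> v = Id C Z"
    unfolding s(2) e_def using add_minus_cancel t ur id_closed by blast
  then show ?thesis
    using is_direct_sum_pairI[OF t(1,3,2,4) r s(1) t(5) ru vs rs vu] by blast
qed

section \<open>Triangulated subcategories and orthogonal decompositions\<close>

text \<open>For an extension, a map out of the middle term vanishes on the first term, hence factors
  through the third, where it is zero again.\<close>

lemma triangulated_subcategory_left_orth: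
  assumes T: "T \<subseteq> Ob C" and shift: "shift C 1 ` T \<subseteq> T" "shift C (-1) ` T \<subseteq> T"
  shows "triangulated_subcategory C (left_orth C T)"
proof -
  \<comment> \<open>Moving \<open>[n]\<close> from source to target turns it into
    \<open>[-n]\<close>, so each shift of the orthogonal uses the opposite shift of
    \<open>T\<close>.\<close>
  have closed: "shift C n ` left_orth C T \<subseteq> left_orth C T" if "shift C (- n) ` T \<subseteq> T" for n
  proof (rule image_subsetI)
    fix Z assume Z: "Z \<in> left_orth C T"
    then have ob: "Z \<in> Ob C" by (simp add: left_orth_def)
    have "Mor C (shift C n Z) W = {Zero C (shift C n Z) W}" if W: "W \<in> T" for W
    proof -
      have "shift C (- n) W \<in> T" using W \<open>shift C (- n) ` T \<subseteq> T\<close> by blast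
      then have "Mor C Z (shift C (- n) W) = {Zero C Z (shift C (- n) W)}"
        using Z by (simp add: left_orth_def)
      then show ?thesis using shift_hom_zero_iff ob W T by blast
    qed
    then show "shift C n Z \<in> left_orth C T" using ob shift_closed by (simp add: left_orth_def)
  qed
  have "extension_product C (left_orth C T) (left_orth C T) \<subseteq> left_orth C T"
  proof
    fix Z assume "Z \<in> extension_product C (left_orth C T) (left_orth C T)"
    then obtain X Y u v w where XY: "X \<in> left_orth C T" "Y \<in> left_orth C T"
      and tri: "(X, Z, Y, u, v, w) \<in> dist_tri C"
      unfolding extension_product_def by blast
    note t = dist_triD[OF tri]
    show "Z \<in> left_orth C T"
    proof (rule left_orthI)
      fix W f assume W: "W \<in> T" and f: "f \<in> Mor C Z W"
      have W': "W \<in> Ob C" using W T by blast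
      have "f \<cdot>\<^bsub>C\<^esub> u \<in> Mor C X W" using f t W' comp_closed by metis
      then have "f \<cdot>\<^bsub>C\<^esub> u = Zero C X W" using left_orthD XY W by blast
      then obtain c where c: "c \<in> Mor C Y W" "c \<cdot>\<^bsub>C\<^esub> v = f"
        using dist_tri_weak_cokernel[OF tri W' f] by blast
      then have "c = Zero C Y W" using left_orthD XY W by blast
      then show "f = Zero C Z W" using c comp_zero_left[OF t(2,3) W' t(5)] by simp
    qed (use T t in auto)
  qed
  then show ?thesis
    using closed[of 1] closed[of "-1"] shift subcategory_left_orth[OF T]
    by (simp add: triangulated_subcategory_def)
qed

text \<open>\<open>T\<close> is merely a set of objects here, so the second factor offered to
  indecomposability is the left orthogonal \<open>T'\<close> of \<open>S\<close>, which contains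
  \<open>T\<close>. What has to be shown is that \<open>S\<close> and \<open>T'\<close> are
  orthogonal on both sides and triangulated.\<close>

lemma decomposition_trivial:
  assumes indec: "indecomposable_category C"
    and S: "subcategory C S" and T: "T \<subseteq> Ob C"
    and ST: "hom_orthogonal C S T" and TS: "hom_orthogonal C T S"
    and decomp: "\<And>Z. Z \<in> Ob C \<Longrightarrow> \<exists>A \<in> S. \<exists>B \<in> T. is_direct_sum C [A, B] Z"
    and e: "e = 1 \<or> e = - 1" and Se: "shift C e ` S \<subseteq> S"
    and TeS: "hom_orthogonal C (shift C e ` T) S"
  shows "S \<subseteq> zero_objects C \<or> T \<subseteq> zero_objects C"
proof -
  define T' where "T' = left_orth C S"
  have SC: "S \<subseteq> Ob C" using S by (simp add: subcategory_def)
  have T'C: "T' \<subseteq> Ob C" by (auto simp: T'_def left_orth_def)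
  have TT': "T \<subseteq> T'" using T TS by (auto simp: T'_def left_orth_def hom_orthogonal_def)
  note iso_S = subcategory_isomorphic[OF S]
  \<comment> \<open>Every \<open>Z\<close> in \<open>T'\<close> is isomorphic to an object of
    \<open>T\<close>: its summand \<open>A\<close> in \<open>S\<close> receives only the zero map
    from \<open>Z\<close>, so \<open>A\<close> is zero. Maps from \<open>S\<close> to
    \<open>Z\<close> then vanish along with those to \<open>B\<close>.\<close>
  have ST': "hom_orthogonal C S T'"
    unfolding hom_orthogonal_def
  proof (intro ballI)
    fix X Z assume X: "X \<in> S" and Z: "Z \<in> T'"
    have ob: "X \<in> Ob C" "Z \<in> Ob C" using X Z SC T'C by auto
    obtain A B where AB: "A \<in> S" "B \<in> T" "is_direct_sum C [A, B] Z" using decomp ob by blast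
    obtain i p where ds: "A \<in> Ob C" "B \<in> Ob C"
      "i \<in> Mor C A Z" "p \<in> Mor C Z A" "p \<cdot>\<^bsub>C\<^esub> i = Id C A"
      using AB(3) by (elim is_direct_sum_pairE) blast
    have "p = Zero C Z A" using left_orthD Z AB ds unfolding T'_def by blast
    then have "A \<in> zero_objects C" using zero_objects_iff_id ds comp_zero_left ob by metis
    then obtain f g where fg: "f \<in> Mor C B Z" "g \<in> Mor C Z B" "f \<cdot>\<^bsub>C\<^esub> g = Id C Z"
      using direct_sum_left_zero[OF AB(3)] unfolding isomorphic_def iso_mor_def by blast
    have "h = Zero C X Z" if h: "h \<in> Mor C X Z" for h
    proof -
      have "g \<cdot>\<^bsub>C\<^esub> h \<in> Mor C X B" using fg h ob ds comp_closed by metis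
      then have gh: "g \<cdot>\<^bsub>C\<^esub> h = Zero C X B" using ST X AB by (auto simp: hom_orthogonal_def)
      have "h = (f \<cdot>\<^bsub>C\<^esub> g) \<cdot>\<^bsub>C\<^esub> h" using fg h ob comp_id_left by metis
      also have "\<dots> = f \<cdot>\<^bsub>C\<^esub> g \<cdot>\<^bsub>C\<^esub> h" using fg h ob ds comp_assoc by metis
      finally show ?thesis using gh comp_zero_right fg ob ds by metis
    qed
    then show "Mor C X Z = {Zero C X Z}" using zero_mor ob by blast
  qed
  \<comment> \<open>If \<open>Z\<close> has no nonzero maps to \<open>T'\<close>, its projection to
    the summand \<open>B\<close> is zero, so \<open>B\<close> is zero and \<open>Z\<close> is
    isomorphic to \<open>A\<close> in \<open>S\<close>.\<close>
  have S_eq: "S = left_orth C T'"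
  proof
    show "S \<subseteq> left_orth C T'"
      using SC ST' by (auto simp: left_orth_def hom_orthogonal_def)
    show "left_orth C T' \<subseteq> S"
    proof
      fix Z assume Z: "Z \<in> left_orth C T'"
      then have ob: "Z \<in> Ob C" by (simp add: left_orth_def)
      obtain A B where AB: "A \<in> S" "B \<in> T" "is_direct_sum C [A, B] Z" using decomp ob by blast
      obtain j q where ds: "A \<in> Ob C" "B \<in> Ob C"
        "j \<in> Mor C B Z" "q \<in> Mor C Z B" "q \<cdot>\<^bsub>C\<^esub> j = Id C B"
        using AB(3) by (elim is_direct_sum_pairE) blast
      have "q = Zero C Z B" using left_orthD Z AB TT' ds by blast
      then have "B \<in> zero_objects C" using zero_objects_iff_id ds comp_zero_left ob by metis
      then show "Z \<in> S" using direct_sum_right_zero[OF AB(3)] iso_S AB ob by blast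
    qed
  qed
  txt \<open>If \<open>X[-e]\<close> is the sum of \<open>A\<close> and \<open>B\<close>, the inclusion of \<open>B\<close> corresponds to a map \<open>B[e] \<rightarrow> X\<close>,
    which vanishes; hence \<open>B\<close> is zero.\<close>
  have Se': "shift C (- e) ` S \<subseteq> S"
  proof (rule image_subsetI)
    fix X assume X: "X \<in> S"
    define Z where "Z = shift C (- e) X"
    have ob: "Z \<in> Ob C" and X_eq: "shift C e Z = X"
      using X SC shift_closed shift_minus' by (auto simp: Z_def)
    obtain A B where AB: "A \<in> S" "B \<in> T" "is_direct_sum C [A, B] Z" using decomp ob by blast
    obtain j q where ds: "A \<in> Ob C" "B \<in> Ob C"
      "j \<in> Mor C B Z" "q \<in> Mor C Z B" "q \<cdot>\<^bsub>C\<^esub> j = Id C B"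
      using AB(3) by (elim is_direct_sum_pairE) blast
    have "Mor C (shift C e B) X = {Zero C (shift C e B) X}"
      using TeS AB X by (auto simp: hom_orthogonal_def)
    then have "Mor C B Z = {Zero C B Z}"
      using shift_hom_zero_iff[of B X e] ds X SC by (auto simp: Z_def)
    then have "j = Zero C B Z" using ds by blast
    then have "B \<in> zero_objects C" using zero_objects_iff_id ds comp_zero_right ob by metis
    then show "shift C (- e) X \<in> S"
      using direct_sum_right_zero[OF AB(3)] iso_S AB ob by (simp add: Z_def)
  qed
  have S_shift: "shift C 1 ` S \<subseteq> S" "shift C (-1) ` S \<subseteq> S" using e Se Se' by auto
  have tri_T': "triangulated_subcategory C T'"
    unfolding T'_def using triangulated_subcategory_left_orth SC S_shift by blast
  \<comment> \<open>Closure of \<open>S\<close> under extensions comes from its description as the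
    left orthogonal of the shift-stable class \<open>T'\<close>.\<close>
  then have tri_S: "triangulated_subcategory C S"
    using triangulated_subcategory_left_orth[OF T'C] S_eq by (simp add: triangulated_subcategory_def)
  have "hom_orthogonal C T' S" by (auto simp: T'_def left_orth_def hom_orthogonal_def)
  moreover have "\<forall>Z \<in> Ob C. \<exists>A \<in> S. \<exists>B \<in> T'. is_direct_sum C [A, B] Z" using decomp TT' by blast
  ultimately have "S \<subseteq> zero_objects C \<or> T' \<subseteq> zero_objects C"
    using indec tri_S tri_T' ST' unfolding indecomposable_category_def by blast
  then show ?thesis using TT' by blast
qed

section \<open>Calabi-Yau duality and cotorsion pairs\<close>

text \<open>The duality embeds \<open>Mor C X Y\<close> into the dual of a zero space. Functionals
  are extensional and send zero to zero, so that dual has at most one element.\<close>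

lemma calabi_yau_hom_zero:
  assumes cy: "calabi_yau K C d" and ob: "X \<in> Ob C" "Y \<in> Ob C"
    and zero: "Mor C Y (shift C d X) = {Zero C Y (shift C d X)}"
  shows "Mor C X Y = {Zero C X Y}"
proof -
  define V where "V = Hom C Y (shift C d X)"
  obtain \<Phi> where \<Phi>: "bij_betw \<Phi> (Mor C X Y) (carrier (dual_space K V))"
    using cy ob unfolding calabi_yau_def V_def by metis
  have mV: "module K V" using hom_module ob shift_closed by (simp add: V_def)
  have carV: "carrier V = {\<zero>\<^bsub>V\<^esub>}" using zero by (simp add: V_def)
  have "\<phi> = \<psi>" if "\<phi> \<in> carrier (dual_space K V)" "\<psi> \<in> carrier (dual_space K V)" for \<phi> \<psi>
  proof -
    have at_zero: "\<chi> \<zero>\<^bsub>V\<^esub> = \<zero>" if "\<chi> \<in> carrier (dual_space K V)" for \<chi>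
    proof -
      have hom: "\<chi> \<in> module_hom K V (regular_module K)" using that by (simp add: dual_space_def)
      have "\<chi> \<zero>\<^bsub>V\<^esub> \<in> carrier K"
        using module_hom_closed[OF hom] carV by (auto simp: regular_module_def)
      moreover have "\<chi> (\<zero> \<odot>\<^bsub>V\<^esub> \<zero>\<^bsub>V\<^esub>) = \<zero> \<otimes> \<chi> \<zero>\<^bsub>V\<^esub>"
        using module_hom_smult[OF hom, of \<zero> "\<zero>\<^bsub>V\<^esub>"] carV by (simp add: regular_module_def)
      moreover have "\<zero> \<odot>\<^bsub>V\<^esub> \<zero>\<^bsub>V\<^esub> = \<zero>\<^bsub>V\<^esub>" using module.smult_r_null[OF mV] by simp
      ultimately show ?thesis by simp
    qed
    have "\<phi> \<in> extensional (carrier V)" "\<psi> \<in> extensional (carrier V)"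
      using that by (simp_all add: dual_space_def)
    then show ?thesis
    proof (rule extensionalityI)
      fix v assume "v \<in> carrier V"
      then show "\<phi> v = \<psi> v" using at_zero[OF that(1)] at_zero[OF that(2)] carV by simp
    qed
  qed
  then have "f = g" if "f \<in> Mor C X Y" "g \<in> Mor C X Y" for f g
    using that bij_betw_imp_inj_on[OF \<Phi>] bij_betwE[OF \<Phi>] by (meson inj_onD)
  then show ?thesis using zero_mor ob by blast
qed

text \<open>The sign \<open>e\<close> is \<open>1\<close> for t-structures and \<open>-1\<close> for co-t-structures.\<close>

lemma cotorsion_pair_trivial:
  assumes cy: "calabi_yau K C d" and indec: "indecomposable_category C"
    and cp: "cotorsion_pair C S T" and Se: "shift C e ` S \<subseteq> S"
    and ed: "e = 1 \<and> d \<le> -1 \<or> e = -1 \<and> d \<ge> 1"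
  shows "(S, T) \<in> {(Ob C, zero_objects C), (zero_objects C, Ob C)}"
proof -
  define U where "U = shift C 1 ` T"
  have S: "subcategory C S" and T: "subcategory C T" and SU: "hom_orthogonal C S U"
    and ext: "Ob C = extension_product C S U"
    using cp by (auto simp: cotorsion_pair_def U_def)
  have SC: "S \<subseteq> Ob C" and TC: "T \<subseteq> Ob C" using S T by (auto simp: subcategory_def)
  then have UC: "U \<subseteq> Ob C" using shift_closed by (auto simp: U_def)
  have Sen: "shift C (e * int n) X \<in> S" if "X \<in> S" for X n
  proof (induction n)
    case 0
    then show ?case using that SC shift_zero by auto
  next
    case (Suc n)
    then have "shift C e (shift C (e * int n) X) \<in> S" using Se by blast
    then show ?case using that SC shift_add by (auto simp: algebra_simps)
  qed
  \<comment> \<open>By duality \<open>Hom(B[m], X)\<close> vanishes if \<open>Hom(X, B[m+d])\<close>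
    does, which is \<open>Hom(X[-m-d], B)\<close> up to shift. The condition on \<open>m\<close>
    says that \<open>-m-d\<close> is a nonnegative multiple of \<open>e\<close>, so that
    \<open>X[-m-d]\<close> stays in \<open>S\<close>.\<close>
  have SU_shift: "Mor C (shift C m B) X = {Zero C (shift C m B) X}"
    if X: "X \<in> S" and B: "B \<in> U" and m: "e * (- m - d) \<ge> 0" for X B m
  proof -
    have ob: "X \<in> Ob C" "B \<in> Ob C" using X B SC UC by auto
    have "- m - d = e * int (nat (e * (- m - d)))" using ed m by auto
    then have "shift C (- m - d) X \<in> S" using Sen X by metis
    then have "Mor C (shift C (- m - d) X) B = {Zero C (shift C (- m - d) X) B}"
      using SU B by (auto simp: hom_orthogonal_def)
    then have "Mor C X (shift C (m + d) B) = {Zero C X (shift C (m + d) B)}"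
      using shift_hom_zero_iff[OF ob, of "- m - d"] by (simp add: algebra_simps)
    then show ?thesis
      using calabi_yau_hom_zero[OF cy, of "shift C m B" X] ob shift_closed
      by (simp add: shift_add add.commute)
  qed
  have US: "hom_orthogonal C U S"
    unfolding hom_orthogonal_def
  proof (intro ballI)
    fix B X assume "B \<in> U" "X \<in> S"
    then show "Mor C B X = {Zero C B X}"
      using SU_shift[of X B 0] ed shift_zero UC by auto
  qed
  \<comment> \<open>For \<open>m = e\<close> the quantity in the condition is
    \<open>-1 - e * d\<close>, that is \<open>\<bar>d\<bar> - 1\<close>, nonnegative because
    \<open>d\<close> is nonzero.\<close>
  have UeS: "hom_orthogonal C (shift C e ` U) S"
    using SU_shift[of _ _ e] ed by (auto simp: hom_orthogonal_def)
  have decomp: "\<exists>A \<in> S. \<exists>B \<in> U. is_direct_sum C [A, B] Z" if Z: "Z \<in> Ob C" for Z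
  proof -
    obtain A B u v w where AB: "A \<in> S" "B \<in> U" and tri: "(A, Z, B, u, v, w) \<in> dist_tri C"
      using Z ext unfolding extension_product_def by blast
    note t = dist_triD[OF tri]
    \<comment> \<open>The choice \<open>m = -1\<close> is the one that reaches the connecting map
      \<open>w\<close>, an element of \<open>Hom(B, A[1])\<close>. The condition reads
      \<open>d - 1 \<ge> 0\<close> for \<open>e = -1\<close> and \<open>1 - d \<ge> 0\<close> for
      \<open>e = 1\<close>.\<close>
    have "Mor C (shift C (-1) B) A = {Zero C (shift C (-1) B) A}"
      using SU_shift[of A B "-1"] AB ed by auto
    then have "Mor C B (shift C 1 A) = {Zero C B (shift C 1 A)}"
      using shift_hom_zero_iff[of B A "-1"] t by simp
    then have "w = Zero C B (shift C 1 A)" using t by blast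
    then show ?thesis using dist_tri_split tri AB by blast
  qed
  have e: "e = 1 \<or> e = -1" using ed by auto
  consider "S \<subseteq> zero_objects C" | "U \<subseteq> zero_objects C"
    using decomposition_trivial[OF indec S UC SU US decomp e Se UeS] by blast
  then show ?thesis
  proof cases
    case 1
    have "Ob C \<subseteq> T"
    proof
      fix Z assume Z: "Z \<in> Ob C"
      \<comment> \<open>Since \<open>U\<close> is \<open>T[1]\<close>, it is \<open>Z[1]\<close>
        that gets decomposed; the zero summand drops out and the isomorphism is shifted
        back.\<close>
      obtain A B where AB: "A \<in> S" "B \<in> T" "is_direct_sum C [A, shift C 1 B] (shift C 1 Z)"
        using decomp[OF shift_closed[OF Z, of 1]] by (auto simp: U_def)
      have B: "B \<in> Ob C" using AB TC by auto
      have "isomorphic C (shift C 1 B) (shift C 1 Z)" using direct_sum_left_zero AB 1 by blast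
      then have "isomorphic C B Z"
        using shift_isomorphic[of "shift C 1 B" "shift C 1 Z" "-1"] B Z shift_closed
        by (simp add: shift_minus)
      then show "Z \<in> T" using subcategory_isomorphic[OF T AB(2) Z] by blast
    qed
    then show ?thesis using 1 TC zero_objects_subset[OF S] by blast
  next
    case 2
    have "T \<subseteq> zero_objects C"
    proof
      fix B assume B: "B \<in> T"
      then have "shift C (-1) (shift C 1 B) \<in> zero_objects C"
        using 2 shift_zero_objects by (auto simp: U_def)
      then show "B \<in> zero_objects C" using B TC shift_minus[of B 1] by auto
    qed
    moreover have "Ob C \<subseteq> S"
    proof
      fix Z assume Z: "Z \<in> Ob C"
      obtain A B where AB: "A \<in> S" "B \<in> U" "is_direct_sum C [A, B] Z" using decomp[OF Z] by blast
      have "isomorphic C A Z" using direct_sum_right_zero AB 2 by blast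
      then show "Z \<in> S" using subcategory_isomorphic[OF S AB(1) Z] by blast
    qed
    ultimately show ?thesis using SC zero_objects_subset[OF T] by blast
  qed
qed

section \<open>The two trivial cotorsion pairs\<close>

lemma subcategory_zero_objects: "subcategory C (zero_objects C)"
  by (simp add: zero_objects_eq_left_orth subcategory_left_orth)

lemma shift_image_Ob: "shift C n ` Ob C = Ob C"
proof
  show "shift C n ` Ob C \<subseteq> Ob C" using shift_closed by blast
  show "Ob C \<subseteq> shift C n ` Ob C"
    using shift_closed shift_minus' by (metis image_eqI subsetI)
qed

lemma shift_image_zero_objects: "shift C n ` zero_objects C = zero_objects C"
proof
  show "shift C n ` zero_objects C \<subseteq> zero_objects C" using shift_zero_objects by blast
  show "zero_objects C \<subseteq> shift C n ` zero_objects C"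
    using shift_zero_objects shift_minus' zero_objects_iff_id by (metis image_eqI subsetI)
qed

text \<open>The triangle on \<open>Id C Z\<close> exhibits every \<open>Z\<close> as an extension
  with a zero object as third term.\<close>

lemma cotorsion_pair_Ob_zero: "cotorsion_pair C (Ob C) (zero_objects C)"
proof -
  obtain N where N: "N \<in> zero_objects C" using zero_object_exists by blast
  have "Z \<in> extension_product C (Ob C) (zero_objects C)" if Z: "Z \<in> Ob C" for Z
    using TR1_id[OF Z N] N Z unfolding extension_product_def by blast
  then have "extension_product C (Ob C) (zero_objects C) = Ob C"
    by (auto simp: extension_product_def)
  moreover have "hom_orthogonal C (Ob C) (zero_objects C)"
    by (auto simp: hom_orthogonal_def zero_objects_def)
  ultimately show ?thesis
    by (simp add: cotorsion_pair_def shift_image_zero_objects subcategory_Ob subcategory_zero_objects)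
qed

text \<open>Here the zero object comes first, in the triangle on \<open>N\<close>, \<open>Z\<close>,
  \<open>Z\<close>.\<close>

lemma cotorsion_pair_zero_Ob: "cotorsion_pair C (zero_objects C) (Ob C)"
proof -
  obtain N where N: "N \<in> zero_objects C" using zero_object_exists by blast
  have "Z \<in> extension_product C (zero_objects C) (Ob C)" if Z: "Z \<in> Ob C" for Z
    using dist_tri_zero_left[OF N Z] N Z unfolding extension_product_def by blast
  then have "extension_product C (zero_objects C) (Ob C) = Ob C"
    by (auto simp: extension_product_def)
  moreover have "hom_orthogonal C (zero_objects C) (Ob C)"
    by (auto simp: hom_orthogonal_def zero_objects_def)
  ultimately show ?thesis
    by (simp add: cotorsion_pair_def shift_image_Ob subcategory_Ob subcategory_zero_objects)
qed

end

theorem proposition4p6: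
  fixes K :: "('k, 'r) ring_scheme"
    and C :: "('k, 'o, 'm, 'z) tri_cat_scheme"
    and d :: int
  assumes "triangulated_category K C"
    and "hom_finite K C"
    and "krull_schmidt C"
    and "calabi_yau K C d"
    and "indecomposable_category C"
  shows "(d \<ge> 1 \<longrightarrow>
      {(S, T). co_t_structure C S T} = {(Ob C, zero_objects C), (zero_objects C, Ob C)}) \<and>
    (d \<le> -1 \<longrightarrow>
      {(S, T). t_structure C S T} = {(Ob C, zero_objects C), (zero_objects C, Ob C)})"
proof -
  interpret triangulated_category K C by fact
  \<comment> \<open>Both trivial pairs have a shift-invariant first component, so each is a
    t-structure and a co-t-structure at once.\<close>
  have "co_t_structure C (Ob C) (zero_objects C)" "co_t_structure C (zero_objects C) (Ob C)"
    "t_structure C (Ob C) (zero_objects C)" "t_structure C (zero_objects C) (Ob C)"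
    by (simp_all add: co_t_structure_def t_structure_def cotorsion_pair_Ob_zero cotorsion_pair_zero_Ob
        shift_image_Ob shift_image_zero_objects)
  moreover have "(S, T) \<in> {(Ob C, zero_objects C), (zero_objects C, Ob C)}"
    if "d \<ge> 1" "co_t_structure C S T" for S T
    using cotorsion_pair_trivial[OF assms(4,5), of S T "-1"] that by (auto simp: co_t_structure_def)
  moreover have "(S, T) \<in> {(Ob C, zero_objects C), (zero_objects C, Ob C)}"
    if "d \<le> -1" "t_structure C S T" for S T
    using cotorsion_pair_trivial[OF assms(4,5), of S T 1] that by (auto simp: t_structure_def)
  ultimately show ?thesis by auto
qed

end
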